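(* In the critical phase of the Curie-Weiss model ($\beta=1$, $h=0$) on $\Omega=\{-1,1\}^N$, for any $f:\Omega\to\mathbb{R}$ that is $1$-Lipschitz with respect to the Hamming distance and for any $t\ge0$, $$\mathbb{P}(|f(X)-\mathbb{E}f(X)|\ge t)\le2\exp\left(-\frac{t^2}{2CN^{3/2}\log(N)}\right),$$ where $X$ is distributed according to the critical Curie-Weiss model and $C$ is a universal constant.
   Context: The critical Curie-Weiss model is the probability distribution on $\{-1,1\}^N$ given by $\pi(\omega)=\exp\left(\frac1N\sum_{1\le i<j\le N}\omega_i\omega_j\right)/Z$ with $Z$ the normalising constant. The Hamming distance is $d(x,y)=\sum_{i=1}^N\mathbf{1}[x_i\ne y_i]$. *)

theory Defs
  imports "HOL-Probability.Probability"
begin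

text \<open>Since the constant in the concentration bound is uniform in \<open>N\<close>, configurations are
  functions on \<open>nat\<close>, restricted to \<open>{1..N}\<close> (and \<open>undefined\<close> elsewhere), rather than
  functions on a finite index type.\<close>

definition spin_configs :: "nat \<Rightarrow> (nat \<Rightarrow> real) set"
  where "spin_configs N = {1..N} \<rightarrow>\<^sub>E {-1, 1}"

definition hamming_dist :: "nat \<Rightarrow> (nat \<Rightarrow> real) \<Rightarrow> (nat \<Rightarrow> real) \<Rightarrow> nat"
  where "hamming_dist N x y = (\<Sum>i\<in>{1..N}. of_bool (x i \<noteq> y i))"

definition hamming_1_Lipschitz :: "nat \<Rightarrow> ((nat \<Rightarrow> real) \<Rightarrow> real) \<Rightarrow> bool"
  where "hamming_1_Lipschitz N f \<longleftrightarrow>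
    (\<forall>x\<in>spin_configs N. \<forall>y\<in>spin_configs N. \<bar>f x - f y\<bar> \<le> real (hamming_dist N x y))"

definition cw_weight :: "nat \<Rightarrow> (nat \<Rightarrow> real) \<Rightarrow> real"
  where "cw_weight N \<omega> =
    exp (1 / real N * (\<Sum>(i, j)\<in>{(i, j). 1 \<le> i \<and> i < j \<and> j \<le> N}. \<omega> i * \<omega> j))"

definition cw_partition :: "nat \<Rightarrow> real"
  where "cw_partition N = (\<Sum>\<omega>\<in>spin_configs N. cw_weight N \<omega>)"

definition critical_curie_weiss :: "nat \<Rightarrow> (nat \<Rightarrow> real) pmf"
  where "critical_curie_weiss N =
    embed_pmf (\<lambda>\<omega>. if \<omega> \<in> spin_configs N then cw_weight N \<omega> / cw_partition N else 0)"

lemma finite_spin_configs: "finite (spin_configs N)"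
  unfolding spin_configs_def by (intro finite_PiE) auto

lemma spin_configs_nonempty: "spin_configs N \<noteq> {}"
  unfolding spin_configs_def by (simp add: PiE_eq_empty_iff)

lemma cw_partition_pos: "0 < cw_partition N"
  unfolding cw_partition_def
  by (intro sum_pos finite_spin_configs spin_configs_nonempty) (simp add: cw_weight_def)

text \<open>The function passed to \<open>embed_pmf\<close> is a probability mass function, so
  \<open>critical_curie_weiss N\<close> has the intended point masses.\<close>

lemma pmf_critical_curie_weiss:
  "pmf (critical_curie_weiss N) \<omega> =
    (if \<omega> \<in> spin_configs N then cw_weight N \<omega> / cw_partition N else 0)"
  unfolding critical_curie_weiss_def
proof (rule pmf_embed_pmf)
  let ?p = "\<lambda>\<omega>. if \<omega> \<in> spin_configs N then cw_weight N \<omega> / cw_partition N else 0"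
  show nonneg: "0 \<le> ?p \<omega>" for \<omega>
    using cw_partition_pos[of N] by (simp add: cw_weight_def)
  have "(\<integral>\<^sup>+\<omega>. ennreal (?p \<omega>) \<partial>count_space UNIV) = (\<Sum>\<omega>\<in>spin_configs N. ennreal (?p \<omega>))"
    by (rule nn_integral_count_space'[OF finite_spin_configs]) auto
  also have "\<dots> = ennreal (\<Sum>\<omega>\<in>spin_configs N. ?p \<omega>)"
    using nonneg by (intro sum_ennreal) blast
  also have "(\<Sum>\<omega>\<in>spin_configs N. ?p \<omega>) = (\<Sum>\<omega>\<in>spin_configs N. cw_weight N \<omega>) / cw_partition N"
    by (simp add: sum_divide_distrib)
  also have "\<dots> = 1"
    using cw_partition_pos[of N] by (simp flip: cw_partition_def)
  finally show "(\<integral>\<^sup>+\<omega>. ennreal (?p \<omega>) \<partial>count_space UNIV) = 1" by simp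
qed

end

theory Submission
  imports Defs
begin

text \<open>Let \<open>\<mu>\<^sub>p\<close> be the law of \<open>N\<close> independent spins that are \<open>1\<close> with probability \<open>p\<close>.
  A configuration with \<open>k\<close> plus spins has Curie-Weiss mass at most \<open>exp (N x\<^sup>2 / 2) / 2\<^sup>N\<close>,
  where \<open>x = 2 k / N - 1\<close>. At the critical temperature the quadratic term cancels against
  that of the entropy, which leaves at most \<open>exp (- N x\<^sup>4 / 12)\<close> times its mass under \<open>\<mu>\<^sub>p\<close>
  with \<open>p = k / N\<close>. Summing over \<open>k\<close> bounds the Curie-Weiss measure by \<open>N + 1\<close> weighted
  product measures. Under \<open>\<mu>\<^sub>p\<close> the function \<open>f\<close> has subgaussian fluctuations of order \<open>\<surd>N\<close>
  (McDiarmid), and its mean differs from its mean \<open>a\<close> under \<open>\<mu>\<^bsub>1/2\<^esub>\<close> by at most \<open>N \<bar>x\<bar> / 2\<close>,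
  which the factor \<open>exp (- N x\<^sup>4 / 12)\<close> confines to order \<open>N\<^bsup>3/4\<^esup>\<close>. So \<open>\<bar>f - a\<bar>\<close> has a
  subgaussian tail at scale \<open>N\<^bsup>3/4\<^esup>\<close> up to the factor \<open>N + 1\<close>; the logarithm in the exponent
  absorbs this factor and the shift from \<open>a\<close> to the true mean.\<close>

subsection \<open>Bounded differences\<close>

text \<open>Fubini for one coordinate, the step behind both inductions over coordinates below.
  Finite supports make every integrand integrable.\<close>

lemma expectation_Pi_pmf_insert:
  fixes h :: "_ \<Rightarrow> real"
  assumes A: "finite A" "x \<notin> A"
    and fin: "\<And>i. i \<in> insert x A \<Longrightarrow> finite (set_pmf (p i))"
  shows "measure_pmf.expectation (Pi_pmf (insert x A) d p) h =
    measure_pmf.expectation (p x) (\<lambda>y. measure_pmf.expectation (Pi_pmf A d p) (\<lambda>w. h (w(x := y))))"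
proof -
  have finA: "finite (set_pmf (Pi_pmf A d p))"
    using A fin by (auto simp: set_Pi_pmf intro!: finite_PiE_dflt)
  have "Pi_pmf (insert x A) d p = p x \<bind> (\<lambda>y. map_pmf (\<lambda>w. w(x := y)) (Pi_pmf A d p))"
    using A by (simp add: Pi_pmf_insert' map_pmf_def)
  then show ?thesis
    using finA fin by (simp add: pmf_expectation_bind[of "set_pmf (p x)"]
        integral_measure_pmf_real[of "set_pmf (p x)"] mult.commute)
qed

lemma abs_expectation_pmf_diff_le:
  fixes g h :: "'a \<Rightarrow> real"
  assumes fin: "finite (set_pmf P)"
    and le: "\<And>w. w \<in> set_pmf P \<Longrightarrow> \<bar>g w - h w\<bar> \<le> c w"
  shows "\<bar>measure_pmf.expectation P g - measure_pmf.expectation P h\<bar> \<le> measure_pmf.expectation P c"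
proof -
  have int: "integrable (measure_pmf P) k" for k :: "'a \<Rightarrow> real"
    by (rule integrable_measure_pmf_finite[OF fin])
  have "measure_pmf.expectation P g - measure_pmf.expectation P h
      = measure_pmf.expectation P (\<lambda>w. g w - h w)"
    by (intro Bochner_Integration.integral_diff[symmetric] int)
  also have "\<bar>\<dots>\<bar> \<le> measure_pmf.expectation P (\<lambda>w. \<bar>g w - h w\<bar>)"
    by (rule integral_abs_bound)
  also have "\<dots> \<le> measure_pmf.expectation P c"
    by (intro integral_mono_AE int) (simp add: AE_measure_pmf_iff le)
  finally show ?thesis .
qed

text \<open>With \<open>a\<close> the minimum of \<open>g\<close> on the support, all values lie in
  \<open>[a, a + c]\<close>, where Hoeffding's lemma applies. The hypothesis bounds the oscillation
  because that is the quantity preserved when other coordinates are averaged out.\<close>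

lemma Hoeffdings_lemma_pmf:
  fixes g :: "'a \<Rightarrow> real"
  assumes fin: "finite (set_pmf p)"
    and osc: "\<And>u v. u \<in> set_pmf p \<Longrightarrow> v \<in> set_pmf p \<Longrightarrow> \<bar>g u - g v\<bar> \<le> c"
    and l: "l > 0"
  shows "measure_pmf.expectation p (\<lambda>x. exp (l * g x))
    \<le> exp (l * measure_pmf.expectation p g + l\<^sup>2 * c\<^sup>2 / 8)"
proof -
  define a where "a = Min (g ` set_pmf p)"
  have "a \<in> g ` set_pmf p"
    unfolding a_def using fin set_pmf_not_empty[of p] by (intro Min_in) auto
  moreover have "a \<le> g y" if "y \<in> set_pmf p" for y
    unfolding a_def using fin that by (intro Min_le) auto
  ultimately have bounds: "a \<le> g y" "g y \<le> a + c" if "y \<in> set_pmf p" for y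
    using osc[OF that] that by (auto simp: abs_le_iff algebra_simps)
  interpret interval_bounded_random_variable "measure_pmf p" g a "a + c"
    by unfold_locales (auto simp: AE_measure_pmf_iff bounds)
  let ?E = "measure_pmf.expectation p g"
  have "measure_pmf.expectation p (\<lambda>x. exp (l * (g x - ?E))) \<le> exp (l\<^sup>2 * c\<^sup>2 / 8)"
  proof -
    have "ennreal (measure_pmf.expectation p (\<lambda>x. exp (l * (g x - ?E))))
        = (\<integral>\<^sup>+ x. exp (l * (g x - ?E)) \<partial>p)"
      by (intro nn_integral_eq_integral[symmetric] integrable_measure_pmf_finite fin) auto
    also have "\<dots> \<le> ennreal (exp (l\<^sup>2 * c\<^sup>2 / 8))"
      using Hoeffdings_lemma_nn_integral[OF l] by simp
    finally show ?thesis by simp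
  qed
  moreover have "measure_pmf.expectation p (\<lambda>x. exp (l * g x))
      = exp (l * ?E) * measure_pmf.expectation p (\<lambda>x. exp (l * (g x - ?E)))"
    by (subst integral_mult_right_zero[symmetric]) (simp add: exp_add[symmetric] algebra_simps)
  ultimately show ?thesis
    by (simp add: exp_add)
qed

text \<open>Condition on the value \<open>y\<close> of one coordinate \<open>x\<close>. The
  induction hypothesis handles the remaining coordinates and leaves \<open>exp (l * M y)\<close>,
  with \<open>M y\<close> the conditional mean. Since \<open>M\<close> oscillates by at most
  \<open>c x\<close>, Hoeffding's lemma for \<open>M\<close> contributes the missing summand
  \<open>(c x)\<^sup>2\<close>.\<close>

lemma mgf_bounded_differences_Pi_pmf:
  fixes f :: "('a \<Rightarrow> 'b) \<Rightarrow> real"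
  assumes A: "finite A" and fin: "\<And>i. i \<in> A \<Longrightarrow> finite (set_pmf (p i))"
    and bd: "\<And>w i u v. w \<in> set_pmf (Pi_pmf A d p) \<Longrightarrow> i \<in> A \<Longrightarrow> u \<in> set_pmf (p i) \<Longrightarrow>
      v \<in> set_pmf (p i) \<Longrightarrow> \<bar>f (w(i := u)) - f (w(i := v))\<bar> \<le> c i"
    and l: "l > 0"
  shows "measure_pmf.expectation (Pi_pmf A d p) (\<lambda>w. exp (l * f w))
    \<le> exp (l * measure_pmf.expectation (Pi_pmf A d p) f + l\<^sup>2 * (\<Sum>i\<in>A. (c i)\<^sup>2) / 8)"
  using A fin bd
proof (induction A arbitrary: f rule: finite_induct)
  case empty
  then show ?case by simp
next
  case (insert x A)
  note [simp] = insert.hyps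
  define M where "M y = measure_pmf.expectation (Pi_pmf A d p) (\<lambda>w. f (w(x := y)))" for y
  let ?s = "\<Sum>i\<in>A. (c i)\<^sup>2"
  have finA: "finite (set_pmf (Pi_pmf A d p))"
    using insert.prems by (auto simp: set_Pi_pmf intro!: finite_PiE_dflt)
  have in_insert: "w(x := y) \<in> set_pmf (Pi_pmf (insert x A) d p)"
    if "w \<in> set_pmf (Pi_pmf A d p)" "y \<in> set_pmf (p x)" for w y
    using that by (auto simp: set_Pi_pmf PiE_dflt_def)
  have IH: "measure_pmf.expectation (Pi_pmf A d p) (\<lambda>w. exp (l * f (w(x := y))))
      \<le> exp (l * M y + l\<^sup>2 * ?s / 8)" if y: "y \<in> set_pmf (p x)" for y
    unfolding M_def
  proof (rule insert.IH)
    fix w i u v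
    assume *: "w \<in> set_pmf (Pi_pmf A d p)" "i \<in> A" "u \<in> set_pmf (p i)" "v \<in> set_pmf (p i)"
    then have "i \<noteq> x" by auto
    moreover have "\<bar>f (w(x := y, i := u)) - f (w(x := y, i := v))\<bar> \<le> c i"
      by (rule insert.prems(2)[OF in_insert[OF *(1) y]]) (use * in auto)
    ultimately show "\<bar>f (w(i := u, x := y)) - f (w(i := v, x := y))\<bar> \<le> c i"
      by (simp add: fun_upd_twist[of i x])
  qed (use insert.prems in auto)
  have osc: "\<bar>M u - M v\<bar> \<le> c x" if uv: "u \<in> set_pmf (p x)" "v \<in> set_pmf (p x)" for u v
  proof -
    have "\<bar>M u - M v\<bar> \<le> measure_pmf.expectation (Pi_pmf A d p) (\<lambda>_. c x)"
      unfolding M_def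
    proof (rule abs_expectation_pmf_diff_le[OF finA])
      fix w assume "w \<in> set_pmf (Pi_pmf A d p)"
      \<comment> \<open>The hypothesis wants a base configuration over \<open>insert x A\<close>.
        \<open>w(x := u)\<close> is one, and a second update at \<open>x\<close> overwrites the
        first.\<close>
      then have "\<bar>f (w(x := u, x := u)) - f (w(x := u, x := v))\<bar> \<le> c x"
        by (intro insert.prems(2)[OF in_insert[OF _ uv(1)]]) (use uv in auto)
      then show "\<bar>f (w(x := u)) - f (w(x := v))\<bar> \<le> c x" by simp
    qed
    then show ?thesis by simp
  qed
  have "measure_pmf.expectation (Pi_pmf (insert x A) d p) (\<lambda>w. exp (l * f w))
      = measure_pmf.expectation (p x)
          (\<lambda>y. measure_pmf.expectation (Pi_pmf A d p) (\<lambda>w. exp (l * f (w(x := y)))))"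
    using insert.prems by (intro expectation_Pi_pmf_insert) auto
  also have "\<dots> \<le> measure_pmf.expectation (p x) (\<lambda>y. exp (l\<^sup>2 * ?s / 8) * exp (l * M y))"
    using insert.prems(1)[of x] IH
    by (intro integral_mono_AE integrable_measure_pmf_finite) 
       (auto simp: AE_measure_pmf_iff exp_add mult.commute)
  also have "\<dots> = exp (l\<^sup>2 * ?s / 8) * measure_pmf.expectation (p x) (\<lambda>y. exp (l * M y))"
    by simp
  also have "\<dots> \<le> exp (l\<^sup>2 * ?s / 8) * exp (l * measure_pmf.expectation (p x) M + l\<^sup>2 * (c x)\<^sup>2 / 8)"
    using insert.prems(1)[of x] osc l by (intro mult_left_mono Hoeffdings_lemma_pmf) auto
  also have "measure_pmf.expectation (p x) M = measure_pmf.expectation (Pi_pmf (insert x A) d p) f"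
    unfolding M_def using insert.prems by (intro expectation_Pi_pmf_insert[symmetric]) auto
  finally show ?case
    by (simp add: exp_add[symmetric] field_simps)
qed

lemma bounded_differences_upper_tail_Pi_pmf:
  fixes f :: "('a \<Rightarrow> 'b) \<Rightarrow> real"
  assumes A: "finite A" and fin: "\<And>i. i \<in> A \<Longrightarrow> finite (set_pmf (p i))"
    and bd: "\<And>w i u v. w \<in> set_pmf (Pi_pmf A d p) \<Longrightarrow> i \<in> A \<Longrightarrow> u \<in> set_pmf (p i) \<Longrightarrow>
      v \<in> set_pmf (p i) \<Longrightarrow> \<bar>f (w(i := u)) - f (w(i := v))\<bar> \<le> c i"
    and S: "(\<Sum>i\<in>A. (c i)\<^sup>2) > 0" and t: "t \<ge> 0"
  shows "measure_pmf.prob (Pi_pmf A d p) {w. f w - measure_pmf.expectation (Pi_pmf A d p) f \<ge> t}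
    \<le> exp (- 2 * t\<^sup>2 / (\<Sum>i\<in>A. (c i)\<^sup>2))"
proof (cases "t = 0")
  case False
  define S where "S = (\<Sum>i\<in>A. (c i)\<^sup>2)"
  \<comment> \<open>This \<open>l\<close> minimises the Chernoff exponent
    \<open>l\<^sup>2 * S / 8 - l * t\<close>; the minimum is \<open>- 2 * t\<^sup>2 / S\<close>. It
    is positive only for \<open>t > 0\<close>; at \<open>t = 0\<close> the claimed bound is
    1.\<close>
  define l where "l = 4 * t / S"
  have pos: "S > 0" "l > 0" using assms False by (auto simp: S_def l_def)
  let ?P = "Pi_pmf A d p"
  let ?E = "measure_pmf.expectation ?P f"
  have finA: "finite (set_pmf ?P)"
    using A fin by (auto simp: set_Pi_pmf intro!: finite_PiE_dflt)
  have "measure_pmf.prob ?P {w. f w - ?E \<ge> t}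
      = measure_pmf.prob ?P {w\<in>space ?P. exp (l * f w) \<ge> exp (l * (?E + t))}"
    using pos by (intro arg_cong[of _ _ "measure_pmf.prob ?P"]) (auto simp: mult_le_cancel_left_pos)
  also have "\<dots> \<le> measure_pmf.expectation ?P (\<lambda>w. exp (l * f w)) / exp (l * (?E + t))"
    by (rule integral_Markov_inequality_measure[where A = "{}"])
       (auto intro!: integrable_measure_pmf_finite finA)
  also have "\<dots> \<le> exp (l * ?E + l\<^sup>2 * S / 8) / exp (l * (?E + t))"
    unfolding S_def using A fin bd pos(2)
    by (intro divide_right_mono mgf_bounded_differences_Pi_pmf) auto
  also have "\<dots> = exp (- 2 * t\<^sup>2 / S)"
    using pos by (simp add: exp_diff[symmetric] l_def power2_eq_square field_simps)
  finally show ?thesis by (simp add: S_def)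
qed simp

lemma McDiarmid_Pi_pmf:
  fixes f :: "('a \<Rightarrow> 'b) \<Rightarrow> real"
  assumes A: "finite A" and fin: "\<And>i. i \<in> A \<Longrightarrow> finite (set_pmf (p i))"
    and bd: "\<And>w i u v. w \<in> set_pmf (Pi_pmf A d p) \<Longrightarrow> i \<in> A \<Longrightarrow> u \<in> set_pmf (p i) \<Longrightarrow>
      v \<in> set_pmf (p i) \<Longrightarrow> \<bar>f (w(i := u)) - f (w(i := v))\<bar> \<le> c i"
    and S: "(\<Sum>i\<in>A. (c i)\<^sup>2) > 0" and t: "t \<ge> 0"
  shows "measure_pmf.prob (Pi_pmf A d p) {w. \<bar>f w - measure_pmf.expectation (Pi_pmf A d p) f\<bar> \<ge> t}
    \<le> 2 * exp (- 2 * t\<^sup>2 / (\<Sum>i\<in>A. (c i)\<^sup>2))"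
proof -
  let ?P = "Pi_pmf A d p"
  let ?E = "measure_pmf.expectation ?P f"
  have "measure_pmf.prob ?P {w. \<bar>f w - ?E\<bar> \<ge> t}
      \<le> measure_pmf.prob ?P ({w. f w - ?E \<ge> t} \<union> {w. - f w - measure_pmf.expectation ?P (\<lambda>w. - f w) \<ge> t})"
    by (intro measure_pmf.finite_measure_mono) auto
  also have "\<dots> \<le> measure_pmf.prob ?P {w. f w - ?E \<ge> t}
      + measure_pmf.prob ?P {w. - f w - measure_pmf.expectation ?P (\<lambda>w. - f w) \<ge> t}"
    by (rule measure_Un_le) auto
  also have "\<dots> \<le> exp (- 2 * t\<^sup>2 / (\<Sum>i\<in>A. (c i)\<^sup>2)) + exp (- 2 * t\<^sup>2 / (\<Sum>i\<in>A. (c i)\<^sup>2))"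
    using assms bd
    by (intro add_mono bounded_differences_upper_tail_Pi_pmf) (auto simp: abs_minus_commute)
  finally show ?thesis by simp
qed

subsection \<open>Independent spins\<close>

definition spin_pmf :: "real \<Rightarrow> real pmf"
  where "spin_pmf p = map_pmf (\<lambda>b. if b then 1 else -1) (bernoulli_pmf p)"

lemma set_spin_pmf: "set_pmf (spin_pmf p) \<subseteq> {-1, 1}"
  by (auto simp: spin_pmf_def)

lemma finite_set_spin_pmf [simp]: "finite (set_pmf (spin_pmf p))"
  by (rule finite_subset[OF set_spin_pmf]) simp

lemma expectation_spin_pmf:
  fixes g :: "real \<Rightarrow> real"
  assumes "0 \<le> p" "p \<le> 1"
  shows "measure_pmf.expectation (spin_pmf p) g = p * g 1 + (1 - p) * g (-1)"
  using assms by (simp add: spin_pmf_def)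

lemma pmf_spin_pmf:
  assumes "0 \<le> p" "p \<le> 1" "s \<in> {-1, 1}"
  shows "pmf (spin_pmf p) s = (if s = 1 then p else 1 - p)"
proof -
  have inj: "inj (\<lambda>b. if b then 1 else (-1::real))"
    by (auto intro!: injI split: if_splits)
  show ?thesis
    using assms pmf_map_inj'[OF inj, of "bernoulli_pmf p" True] pmf_map_inj'[OF inj, of "bernoulli_pmf p" False]
    by (auto simp: spin_pmf_def)
qed

text \<open>The default value \<open>undefined\<close> makes samples extensional on
  \<open>{1..N}\<close>, so that they are elements of \<open>spin_configs N\<close>.\<close>

definition iid_spins :: "nat \<Rightarrow> real \<Rightarrow> (nat \<Rightarrow> real) pmf"
  where "iid_spins N p = Pi_pmf {1..N} undefined (\<lambda>_. spin_pmf p)"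

lemma card_plus_spins_le: "card {i\<in>{1..N}. w i = (1::real)} \<le> N"
  by (rule order_trans[OF card_mono[of "{1..N}"]]) auto

lemma set_iid_spins: "set_pmf (iid_spins N p) \<subseteq> spin_configs N"
  using set_spin_pmf[of p]
  by (fastforce simp: iid_spins_def set_Pi_pmf PiE_dflt_def spin_configs_def PiE_iff extensional_def)

lemma pmf_iid_spins:
  assumes "0 \<le> p" "p \<le> 1" "w \<in> spin_configs N"
  shows "pmf (iid_spins N p) w
    = p ^ card {i\<in>{1..N}. w i = 1} * (1 - p) ^ (N - card {i\<in>{1..N}. w i = 1})"
proof -
  have plus: "{1..N} \<inter> {i. w i = 1} = {i\<in>{1..N}. w i = 1}"
    and minus: "{1..N} \<inter> - {i. w i = 1} = {1..N} - {i\<in>{1..N}. w i = 1}"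
    by auto
  have "pmf (iid_spins N p) w = (\<Prod>i\<in>{1..N}. pmf (spin_pmf p) (w i))"
    unfolding iid_spins_def using assms(3) by (intro pmf_Pi') (auto simp: spin_configs_def PiE_iff extensional_def)
  also have "\<dots> = (\<Prod>i\<in>{1..N}. if w i = 1 then p else 1 - p)"
    using assms by (intro prod.cong refl pmf_spin_pmf) (auto simp: spin_configs_def)
  also have "(\<Prod>i\<in>{1..N}. if w i = 1 then p else 1 - p)
      = p ^ card {i\<in>{1..N}. w i = 1} * (1 - p) ^ card ({1..N} - {i\<in>{1..N}. w i = 1})"
    by (simp only: prod.If_cases[OF finite_atLeastAtMost] prod_constant plus minus)
  also have "card ({1..N} - {i\<in>{1..N}. w i = 1}) = N - card {i\<in>{1..N}. w i = 1}"
    by (subst card_Diff_subset) auto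
  finally show ?thesis .
qed

text \<open>Changing the bias of a single spin from \<open>q\<close> to \<open>p\<close> moves the
  mean by at most \<open>c * \<bar>p - q\<bar>\<close>, and the spins are changed one at a time by
  induction. Differences are bounded on all sign configurations, not just on a support, because the
  supports for \<open>p\<close> and \<open>q\<close> differ when one of them is 0 or 1.\<close>

lemma expectation_Pi_spin_pmf_Lipschitz:
  fixes f :: "('a \<Rightarrow> real) \<Rightarrow> real"
  assumes A: "finite A" and p: "0 \<le> p" "p \<le> 1" and q: "0 \<le> q" "q \<le> 1"
    and bd: "\<And>w i. w \<in> PiE_dflt A d (\<lambda>_. {-1, 1}) \<Longrightarrow> i \<in> A \<Longrightarrow>
      \<bar>f (w(i := 1)) - f (w(i := -1))\<bar> \<le> c"
  shows "\<bar>measure_pmf.expectation (Pi_pmf A d (\<lambda>_. spin_pmf p)) f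
    - measure_pmf.expectation (Pi_pmf A d (\<lambda>_. spin_pmf q)) f\<bar> \<le> real (card A) * c * \<bar>p - q\<bar>"
  using A bd
proof (induction A arbitrary: f rule: finite_induct)
  case (insert x A)
  note [simp] = insert.hyps
  define P where "P r = Pi_pmf A d (\<lambda>_. spin_pmf r)" for r
  define M where "M r y = measure_pmf.expectation (P r) (\<lambda>w. f (w(x := y)))" for r y
  have in_insert: "w(x := y) \<in> PiE_dflt (insert x A) d (\<lambda>_. {-1, 1})"
    if "w \<in> PiE_dflt A d (\<lambda>_. {-1, 1})" "y \<in> {-1, 1}" for w y
    using that by (auto simp: PiE_dflt_def)
  have set_P: "set_pmf (P r) \<subseteq> PiE_dflt A d (\<lambda>_. {-1, 1})" for r
    using set_spin_pmf[of r] by (fastforce simp: P_def set_Pi_pmf PiE_dflt_def)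
  have fin_P: "finite (set_pmf (P r))" for r
    by (rule finite_subset[OF set_P]) auto
  have rec: "measure_pmf.expectation (Pi_pmf (insert x A) d (\<lambda>_. spin_pmf r)) f
      = r * M r 1 + (1 - r) * M r (-1)" if "0 \<le> r" "r \<le> 1" for r
    using that by (simp add: expectation_Pi_pmf_insert expectation_spin_pmf M_def P_def)
  have IH: "\<bar>M p y - M q y\<bar> \<le> real (card A) * c * \<bar>p - q\<bar>" if y: "y \<in> {-1, 1}" for y
    unfolding M_def P_def
  proof (rule insert.IH)
    fix w i assume *: "w \<in> PiE_dflt A d (\<lambda>_. {-1, 1::real})" "i \<in> A"
    then have "i \<noteq> x" by auto
    moreover have "\<bar>f (w(x := y, i := 1)) - f (w(x := y, i := -1))\<bar> \<le> c"
      by (rule insert.prems[OF in_insert[OF *(1) y]]) (use * in auto)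
    ultimately show "\<bar>f (w(i := 1, x := y)) - f (w(i := - 1, x := y))\<bar> \<le> c"
      by (simp add: fun_upd_twist[of i x])
  qed
  have osc: "\<bar>M p 1 - M p (-1)\<bar> \<le> c"
  proof -
    have "\<bar>M p 1 - M p (-1)\<bar> \<le> measure_pmf.expectation (P p) (\<lambda>_. c)"
      unfolding M_def
    proof (rule abs_expectation_pmf_diff_le[OF fin_P])
      fix w assume "w \<in> set_pmf (P p)"
      with set_P have "w \<in> PiE_dflt A d (\<lambda>_. {-1, 1})" by blast
      then have "\<bar>f (w(x := 1, x := 1)) - f (w(x := 1, x := -1))\<bar> \<le> c"
        by (intro insert.prems[OF in_insert]) auto
      then show "\<bar>f (w(x := 1)) - f (w(x := -1))\<bar> \<le> c" by simp
    qed
    then show ?thesis by simp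
  qed
  let ?D = "real (card A) * c * \<bar>p - q\<bar>"
  \<comment> \<open>Telescoping: first the bias of \<open>x\<close> changes while the other spins
    keep \<open>p\<close>, then the other spins change while \<open>x\<close> has bias
    \<open>q\<close>.\<close>
  have "\<bar>(p * M p 1 + (1 - p) * M p (-1)) - (q * M q 1 + (1 - q) * M q (-1))\<bar>
      = \<bar>(p - q) * (M p 1 - M p (-1)) + (q * (M p 1 - M q 1) + (1 - q) * (M p (-1) - M q (-1)))\<bar>"
    by (simp add: algebra_simps)
  also have "\<dots> \<le> \<bar>p - q\<bar> * \<bar>M p 1 - M p (-1)\<bar> + (q * \<bar>M p 1 - M q 1\<bar> + (1 - q) * \<bar>M p (-1) - M q (-1)\<bar>)"
    using q by (intro order_trans[OF abs_triangle_ineq] add_mono) (auto simp: abs_mult)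
  also have "\<dots> \<le> \<bar>p - q\<bar> * c + (q * ?D + (1 - q) * ?D)"
    using q osc IH by (intro add_mono mult_left_mono) auto
  also have "\<dots> = real (card (insert x A)) * c * \<bar>p - q\<bar>"
    by (simp add: algebra_simps)
  finally show ?case using p q by (simp add: rec)
qed simp

section \<open>Hamming-Lipschitz functions of independent spins\<close>

lemma hamming_1_Lipschitz_fun_upd:
  assumes f: "hamming_1_Lipschitz N f" and w: "w \<in> spin_configs N" and i: "i \<in> {1..N}"
    and uv: "u \<in> {-1, 1}" "v \<in> {-1, 1}"
  shows "\<bar>f (w(i := u)) - f (w(i := v))\<bar> \<le> 1"
proof -
  have "w(i := y) \<in> spin_configs N" if "y \<in> {-1, 1}" for y
    using w i that by (auto simp: spin_configs_def PiE_iff extensional_def)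
  then have "\<bar>f (w(i := u)) - f (w(i := v))\<bar> \<le> real (hamming_dist N (w(i := u)) (w(i := v)))"
    using f uv by (auto simp: hamming_1_Lipschitz_def)
  also have "\<dots> \<le> real (\<Sum>j\<in>{1..N}. of_bool (j = i))"
    unfolding hamming_dist_def of_nat_le_iff by (intro sum_mono) auto
  also have "\<dots> = 1"
    using i by simp
  finally show ?thesis .
qed

lemma hamming_1_Lipschitz_diff_le:
  assumes "hamming_1_Lipschitz N f" "v \<in> spin_configs N" "w \<in> spin_configs N"
  shows "\<bar>f v - f w\<bar> \<le> real N"
proof -
  have "hamming_dist N v w \<le> (\<Sum>i\<in>{1..N}. 1)"
    unfolding hamming_dist_def by (intro sum_mono) auto
  moreover have "\<bar>f v - f w\<bar> \<le> real (hamming_dist N v w)"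
    using assms by (auto simp: hamming_1_Lipschitz_def)
  ultimately show ?thesis by simp
qed

lemma iid_spins_concentration:
  assumes f: "hamming_1_Lipschitz N f" and N: "N > 0" and t: "t \<ge> 0"
  shows "measure_pmf.prob (iid_spins N p) {w. \<bar>f w - measure_pmf.expectation (iid_spins N p) f\<bar> \<ge> t}
    \<le> 2 * exp (- 2 * t\<^sup>2 / N)"
proof -
  have "measure_pmf.prob (iid_spins N p) {w. \<bar>f w - measure_pmf.expectation (iid_spins N p) f\<bar> \<ge> t}
      \<le> 2 * exp (- 2 * t\<^sup>2 / (\<Sum>i\<in>{1..N}. (1::real)\<^sup>2))"
    unfolding iid_spins_def
  proof (rule McDiarmid_Pi_pmf)
    fix w i u v
    assume "w \<in> set_pmf (Pi_pmf {1..N} undefined (\<lambda>_. spin_pmf p))" "i \<in> {1..N}"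
      "u \<in> set_pmf (spin_pmf p)" "v \<in> set_pmf (spin_pmf p)"
    then show "\<bar>f (w(i := u)) - f (w(i := v))\<bar> \<le> 1"
      using set_iid_spins[of N p] set_spin_pmf[of p]
      by (intro hamming_1_Lipschitz_fun_upd[OF f]) (auto simp: iid_spins_def)
  qed (use N t in auto)
  then show ?thesis by simp
qed

lemma iid_spins_expectation_Lipschitz:
  assumes f: "hamming_1_Lipschitz N f" and p: "0 \<le> p" "p \<le> 1" and q: "0 \<le> q" "q \<le> 1"
  shows "\<bar>measure_pmf.expectation (iid_spins N p) f - measure_pmf.expectation (iid_spins N q) f\<bar>
    \<le> real N * \<bar>p - q\<bar>"
proof -
  have "\<bar>measure_pmf.expectation (iid_spins N p) f - measure_pmf.expectation (iid_spins N q) f\<bar>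
      \<le> real (card {1..N}) * 1 * \<bar>p - q\<bar>"
    unfolding iid_spins_def
  proof (rule expectation_Pi_spin_pmf_Lipschitz[OF _ p q])
    fix w i assume "w \<in> PiE_dflt {1..N} undefined (\<lambda>_. {-1, 1::real})" "i \<in> {1..N}"
    then show "\<bar>f (w(i := 1)) - f (w(i := - 1))\<bar> \<le> 1"
      by (intro hamming_1_Lipschitz_fun_upd[OF f])
         (auto simp: spin_configs_def PiE_dflt_def PiE_iff extensional_def)
  qed auto
  then show ?thesis by simp
qed

subsection \<open>Domination by product measures\<close>

text \<open>For spins the diagonal part is constant, so this turns the pair interaction into a
  function of the total spin alone. In the induction, the new pairs are those whose larger index is
  \<open>Suc N\<close>.\<close>

lemma sum_power2_eq_diagonal_plus_pairs:
  fixes w :: "nat \<Rightarrow> real"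
  shows "(\<Sum>i\<in>{1..N}. w i)\<^sup>2
    = (\<Sum>i\<in>{1..N}. (w i)\<^sup>2) + 2 * (\<Sum>(i, j)\<in>{(i, j). 1 \<le> i \<and> i < j \<and> j \<le> N}. w i * w j)"
proof (induction N)
  case 0
  have empty: "{(i, j). 1 \<le> i \<and> i < j \<and> j \<le> (0::nat)} = {}" by auto
  show ?case by (simp only: empty) simp
next
  case (Suc N)
  let ?T = "\<lambda>N::nat. {(i, j). 1 \<le> i \<and> i < j \<and> j \<le> N}"
  have fin: "finite (?T N)"
    by (rule finite_subset[of _ "{1..N} \<times> {1..N}"]) auto
  have "?T (Suc N) = ?T N \<union> (\<lambda>i. (i, Suc N)) ` {1..N}"
    by (auto simp: le_Suc_eq)
  then have "(\<Sum>(i, j)\<in>?T (Suc N). w i * w j)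
      = (\<Sum>(i, j)\<in>?T N. w i * w j) + (\<Sum>(i, j)\<in>(\<lambda>i. (i, Suc N)) ` {1..N}. w i * w j)"
    using fin by (simp only:) (rule sum.union_disjoint, auto)
  also have "(\<Sum>(i, j)\<in>(\<lambda>i. (i, Suc N)) ` {1..N}. w i * w j) = (\<Sum>i\<in>{1..N}. w i) * w (Suc N)"
    by (subst sum.reindex) (auto simp: inj_on_def sum_distrib_right)
  finally show ?case
    using Suc.IH by (simp add: power2_eq_square algebra_simps)
qed

text \<open>Spins square to 1, so the diagonal of the squared sum is \<open>N\<close>; divided by
  \<open>2 * N\<close> it becomes the constant \<open>1 / 2\<close>.\<close>

lemma cw_weight_eq:
  assumes w: "w \<in> spin_configs N" and N: "N > 0"
  shows "cw_weight N w = exp ((\<Sum>i\<in>{1..N}. w i)\<^sup>2 / (2 * N) - 1 / 2)"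
proof -
  have "(\<Sum>i\<in>{1..N}. (w i)\<^sup>2) = (\<Sum>i\<in>{1..N}. 1)"
    using w by (intro sum.cong refl) (auto simp: spin_configs_def PiE_iff power2_eq_1_iff)
  then show ?thesis
    using sum_power2_eq_diagonal_plus_pairs[of w N] N
    by (simp add: cw_weight_def field_simps)
qed

text \<open>Dropping the nonnegative square leaves \<open>exp (- 1 / 2)\<close> for each of the
  \<open>2 ^ N\<close> configurations. This factor later cancels the one in
  \<open>cw_weight_eq\<close>.\<close>

lemma cw_partition_ge:
  assumes N: "N > 0"
  shows "2 ^ N * exp (- 1 / 2) \<le> cw_partition N"
proof -
  have "(\<Sum>w\<in>spin_configs N. exp (- 1 / 2)) \<le> (\<Sum>w\<in>spin_configs N. cw_weight N w)"
    by (intro sum_mono) (simp add: cw_weight_eq N)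
  then show ?thesis
    by (simp add: cw_partition_def spin_configs_def card_PiE numeral_2_eq_2)
qed

section \<open>The entropy gain of fourth order\<close>

text \<open>The left side consists of the first two terms of the power series of the right side,
  whose coefficients are all nonnegative. In the proof, \<open>h\<close> is the difference of the
  sides, \<open>g\<close> is its derivative, and \<open>g\<close> has derivative
  \<open>2 * z ^ 4 / ((1 + z) * (1 - z))\<close>; both vanish at 0.\<close>

lemma entropy_quartic_ge_nonneg:
  fixes x :: real
  assumes x: "0 \<le> x" "x < 1"
  shows "x\<^sup>2 + x ^ 4 / 6 \<le> (1 + x) * ln (1 + x) + (1 - x) * ln (1 - x)"
proof -
  define g where "g x = ln (1 + x) - ln (1 - x) - 2 * x - 2 / 3 * x ^ 3" for x :: real
  define h where "h x = (1 + x) * ln (1 + x) + (1 - x) * ln (1 - x) - x\<^sup>2 - x ^ 4 / 6" for x :: real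
  have "g 0 \<le> g y" if "0 \<le> y" "y < 1" for y
  proof (rule DERIV_nonneg_imp_nondecreasing[OF that(1)])
    fix z :: real assume z: "0 \<le> z" "z \<le> y"
    with that have z1: "z < 1" by simp
    have "(g has_real_derivative (1 / (1 + z) + 1 / (1 - z) - 2 - 2 * z\<^sup>2)) (at z)"
      unfolding g_def using z z1
      by (auto intro!: derivative_eq_intros)
    moreover have "1 / (1 + z) + 1 / (1 - z) - 2 - 2 * z\<^sup>2 = 2 * z ^ 4 / ((1 + z) * (1 - z))"
      using z z1 by (simp add: divide_simps) (simp add: algebra_simps power2_eq_square power4_eq_xxxx)
    moreover have "2 * z ^ 4 / ((1 + z) * (1 - z)) \<ge> 0"
      using z z1 by (intro divide_nonneg_nonneg mult_nonneg_nonneg) auto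
    ultimately show "\<exists>d. (g has_real_derivative d) (at z) \<and> 0 \<le> d" by metis
  qed
  then have g: "0 \<le> g y" if "0 \<le> y" "y < 1" for y
    using that by (force simp: g_def)
  have "h 0 \<le> h x"
  proof (rule DERIV_nonneg_imp_nondecreasing[OF x(1)])
    fix z :: real assume z: "0 \<le> z" "z \<le> x"
    with x have z1: "z < 1" by simp
    have nz: "1 + z \<noteq> 0" "1 - z \<noteq> 0" using z z1 by auto
    have "(h has_real_derivative g z) (at z)"
      unfolding g_def h_def using z z1 nz
      by (auto intro!: derivative_eq_intros)
    with g z z1 show "\<exists>d. (h has_real_derivative d) (at z) \<and> 0 \<le> d" by blast
  qed
  then show ?thesis by (simp add: h_def)
qed

lemma entropy_quartic_ge:
  fixes x :: real
  assumes "\<bar>x\<bar> < 1"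
  shows "x\<^sup>2 + x ^ 4 / 6 \<le> (1 + x) * ln (1 + x) + (1 - x) * ln (1 - x)"
  using entropy_quartic_ge_nonneg[of "\<bar>x\<bar>"] assms by (cases "x \<ge> 0") (auto simp: add.commute)

text \<open>Up to the factor \<open>2 ^ N\<close>, the logarithm of
  \<open>p ^ k * (1 - p) ^ (N - k)\<close> is \<open>N / 2\<close> times the entropy expression of
  \<open>entropy_quartic_ge\<close>. Its quadratic term accounts for
  \<open>N * x\<^sup>2 / 2\<close>, and its quartic term pays for the factor
  \<open>exp (- (N * x ^ 4 / 12))\<close>.\<close>

lemma binomial_weight_ge:
  fixes N k :: nat
  assumes N: "N > 0" and k: "k \<le> N"
  defines "p \<equiv> real k / real N"
  defines "x \<equiv> 2 * p - 1"
  shows "exp (real N * x\<^sup>2 / 2) / 2 ^ N \<le> exp (- (real N * x ^ 4 / 12)) * (p ^ k * (1 - p) ^ (N - k))"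
proof (cases "k = 0 \<or> k = N")
  case True
  \<comment> \<open>At the endpoints one of \<open>p\<close> and \<open>1 - p\<close> is 0 and its
    logarithm is of no use. There \<open>x\<^sup>2 = 1\<close>, and the claim reduces to
    \<open>1/2 + 1/12 = 7/12 \<le> ln 2\<close>.\<close>
  have "exp (7 / 12 * real N) \<le> exp (ln 2 * real N)"
    using ln2_ge_two_thirds by (intro iffD2[OF exp_le_cancel_iff] mult_right_mono) auto
  also have "\<dots> = 2 ^ N"
    by (simp add: exp_of_nat2_mult)
  finally have "exp (real N / 2) * exp (real N / 12) \<le> 2 ^ N"
    by (simp add: exp_add[symmetric] field_simps)
  then have "exp (real N / 2) / 2 ^ N \<le> exp (- (real N / 12))"
    by (simp add: exp_minus field_simps)
  moreover have "p ^ k * (1 - p) ^ (N - k) = 1" "x\<^sup>2 = 1" "x ^ 4 = 1"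
    using True N by (auto simp: p_def x_def)
  ultimately show ?thesis by simp
next
  case False
  then have k': "0 < k" "k < N" using k by auto
  have p: "0 < p" "p < 1" using k' by (auto simp: p_def)
  then have x: "\<bar>x\<bar> < 1" by (auto simp: x_def)
  have p_eq: "p = (1 + x) / 2" and q_eq: "1 - p = (1 - x) / 2"
    by (auto simp: x_def field_simps)
  have kp: "real k = real N * (1 + x) / 2" and Nkp: "real (N - k) = real N * (1 - x) / 2"
    using N k by (auto simp: p_def x_def of_nat_diff field_simps)
  have "p ^ k * (1 - p) ^ (N - k) = exp (real k * ln p + real (N - k) * ln (1 - p))"
    using p by (simp add: exp_add exp_of_nat_mult)
  also have "ln p = ln (1 + x) - ln 2"
    using x ln_div[of "1 + x" 2] by (simp add: p_eq)
  also have "ln (1 - p) = ln (1 - x) - ln 2"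
    using x ln_div[of "1 - x" 2] by (simp add: q_eq)
  also have "real k * (ln (1 + x) - ln 2) + real (N - k) * (ln (1 - x) - ln 2)
      = real N / 2 * ((1 + x) * ln (1 + x) + (1 - x) * ln (1 - x)) - real N * ln 2"
    unfolding kp Nkp by (simp add: field_simps)
  finally have prod: "p ^ k * (1 - p) ^ (N - k)
      = exp (real N / 2 * ((1 + x) * ln (1 + x) + (1 - x) * ln (1 - x)) - real N * ln 2)" .
  have "real N / 2 * (x\<^sup>2 + x ^ 4 / 6) \<le> real N / 2 * ((1 + x) * ln (1 + x) + (1 - x) * ln (1 - x))"
    by (intro mult_left_mono entropy_quartic_ge x) auto
  then have "real N * x\<^sup>2 / 2 - real N * ln 2
      \<le> - (real N * x ^ 4 / 12) + (real N / 2 * ((1 + x) * ln (1 + x) + (1 - x) * ln (1 - x)) - real N * ln 2)"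
    by (simp add: algebra_simps)
  then have "exp (real N * x\<^sup>2 / 2 - real N * ln 2)
      \<le> exp (- (real N * x ^ 4 / 12)) * (p ^ k * (1 - p) ^ (N - k))"
    unfolding prod exp_add[symmetric] by simp
  then show ?thesis
    by (simp add: exp_diff exp_of_nat_mult)
qed

section \<open>Comparison of the Curie-Weiss measure with product measures\<close>

lemma sum_spins_eq:
  assumes w: "w \<in> spin_configs N"
  shows "(\<Sum>i\<in>{1..N}. w i) = 2 * real (card {i\<in>{1..N}. w i = 1}) - real N"
proof -
  have "(\<Sum>i\<in>{1..N}. w i) = (\<Sum>i\<in>{1..N}. 2 * of_bool (w i = 1) - 1)"
    using w by (intro sum.cong refl) (auto simp: spin_configs_def PiE_iff)
  also have "\<dots> = 2 * real (card ({1..N} \<inter> {i. w i = 1})) - real N"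
    by (simp add: sum_subtractf sum_distrib_left[symmetric])
  also have "{1..N} \<inter> {i. w i = 1} = {i\<in>{1..N}. w i = 1}"
    by auto
  finally show ?thesis .
qed

text \<open>The bias \<open>p\<close> is the fraction of plus spins in \<open>w\<close> itself, so
  the comparison measure depends on \<open>w\<close>; the sum over all \<open>k\<close> in the next
  lemma removes this dependence.\<close>

lemma pmf_critical_curie_weiss_le:
  assumes w: "w \<in> spin_configs N" and N: "N > 0"
  defines "p \<equiv> real (card {i\<in>{1..N}. w i = 1}) / real N"
  shows "pmf (critical_curie_weiss N) w
    \<le> exp (- (real N * (2 * p - 1) ^ 4 / 12)) * pmf (iid_spins N p) w"
proof -
  let ?k = "card {i\<in>{1..N}. w i = 1}"
  have k: "?k \<le> N"
    by (rule card_plus_spins_le)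
  have sum: "(\<Sum>i\<in>{1..N}. w i) = real N * (2 * p - 1)"
    unfolding sum_spins_eq[OF w] p_def using N by (simp add: field_simps)
  have "pmf (critical_curie_weiss N) w = cw_weight N w / cw_partition N"
    using w by (simp add: pmf_critical_curie_weiss)
  also have "\<dots> \<le> cw_weight N w / (2 ^ N * exp (- 1 / 2))"
    using cw_partition_ge[OF N] by (intro divide_left_mono) (auto simp: cw_weight_def cw_partition_pos)
  also have "\<dots> = exp (real N * (2 * p - 1)\<^sup>2 / 2) / 2 ^ N"
  proof -
    have "(real N * (2 * p - 1))\<^sup>2 / (2 * real N) = real N * (2 * p - 1)\<^sup>2 / 2"
      using N by (simp add: power_mult_distrib power2_eq_square[of "real N"])
    then show ?thesis
      unfolding cw_weight_eq[OF w N] sum by (simp add: diff_conv_add_uminus exp_add del: add_uminus_conv_diff)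
  qed
  also have "\<dots> \<le> exp (- (real N * (2 * p - 1) ^ 4 / 12)) * (p ^ ?k * (1 - p) ^ (N - ?k))"
    unfolding p_def by (rule binomial_weight_ge[OF N k])
  also have "p ^ ?k * (1 - p) ^ (N - ?k) = pmf (iid_spins N p) w"
    using k N by (intro pmf_iid_spins[symmetric] w) (auto simp: p_def)
  finally show ?thesis .
qed

text \<open>Each configuration is dominated by the term whose \<open>k\<close> is its own number of
  plus spins, and the other terms are nonnegative.\<close>

lemma prob_critical_curie_weiss_le:
  assumes N: "N > 0"
  shows "measure_pmf.prob (critical_curie_weiss N) E
    \<le> (\<Sum>k\<le>N. exp (- (real N * (2 * (real k / real N) - 1) ^ 4 / 12))
        * measure_pmf.prob (iid_spins N (real k / real N)) E)"
proof -
  let ?\<pi> = "critical_curie_weiss N"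
  let ?\<mu> = "\<lambda>k. iid_spins N (real k / real N)"
  let ?c = "\<lambda>k::nat. exp (- (real N * (2 * (real k / real N) - 1) ^ 4 / 12))"
  have fin: "finite (E \<inter> spin_configs N)"
    using finite_spin_configs by blast
  have "set_pmf ?\<pi> \<subseteq> spin_configs N"
    by (auto simp: set_pmf_iff pmf_critical_curie_weiss split: if_splits)
  then have "measure_pmf.prob ?\<pi> E = measure_pmf.prob ?\<pi> (E \<inter> spin_configs N)"
    by (intro measure_pmf.finite_measure_eq_AE) (auto simp: AE_measure_pmf_iff)
  also have "\<dots> = (\<Sum>w\<in>E \<inter> spin_configs N. pmf ?\<pi> w)"
    by (rule measure_measure_pmf_finite[OF fin])
  also have "\<dots> \<le> (\<Sum>w\<in>E \<inter> spin_configs N. \<Sum>k\<le>N. ?c k * pmf (?\<mu> k) w)"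
  proof (rule sum_mono)
    fix w assume w: "w \<in> E \<inter> spin_configs N"
    let ?k = "card {i\<in>{1..N}. w i = 1}"
    have k: "?k \<in> {..N}"
      using card_plus_spins_le[of N w] by simp
    have "pmf ?\<pi> w \<le> ?c ?k * pmf (?\<mu> ?k) w"
      using w by (intro pmf_critical_curie_weiss_le N) auto
    also have "\<dots> \<le> (\<Sum>k\<le>N. ?c k * pmf (?\<mu> k) w)"
      by (rule member_le_sum[OF k]) auto
    finally show "pmf ?\<pi> w \<le> (\<Sum>k\<le>N. ?c k * pmf (?\<mu> k) w)" .
  qed
  also have "\<dots> = (\<Sum>k\<le>N. ?c k * measure_pmf.prob (?\<mu> k) (E \<inter> spin_configs N))"
    by (subst sum.swap) (simp add: measure_measure_pmf_finite[OF fin] sum_distrib_left)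
  also have "\<dots> \<le> (\<Sum>k\<le>N. ?c k * measure_pmf.prob (?\<mu> k) E)"
    by (intro sum_mono mult_left_mono measure_pmf.finite_measure_mono) auto
  finally show ?thesis .
qed

subsection \<open>Concentration\<close>

text \<open>Each of the \<open>N + 1\<close> product measures contributes at most
  \<open>2 * exp (- (t\<^sup>2 / (6 * V)))\<close>: for small magnetisation \<open>x\<close> by
  McDiarmid's inequality, for large \<open>x\<close> by the quartic weight.\<close>

lemma critical_curie_weiss_tail:
  assumes f: "hamming_1_Lipschitz N f" and N: "N \<ge> 1" and t: "t \<ge> 0"
  shows "measure_pmf.prob (critical_curie_weiss N)
      {w. \<bar>f w - measure_pmf.expectation (iid_spins N (1/2)) f\<bar> \<ge> t}
    \<le> 2 * (real N + 1) * exp (- (t\<^sup>2 / (6 * real N powr (3/2))))"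
proof -
  define a where "a = measure_pmf.expectation (iid_spins N (1/2)) f"
  define V where "V = real N powr (3/2)"
  have V: "V > 0" "V \<ge> real N" "V\<^sup>2 = real N ^ 3"
  proof -
    show "V > 0" using N by (simp add: V_def)
    have "real N powr 1 \<le> V" unfolding V_def using N by (intro powr_mono) auto
    then show "V \<ge> real N" by simp
    have "V\<^sup>2 = real N powr 3" by (simp add: V_def power2_eq_square powr_add[symmetric])
    then show "V\<^sup>2 = real N ^ 3" using N by simp
  qed
  have mixture: "exp (- (real N * (2 * (real k / real N) - 1) ^ 4 / 12))
      * measure_pmf.prob (iid_spins N (real k / real N)) {w. \<bar>f w - a\<bar> \<ge> t}
    \<le> 2 * exp (- (t\<^sup>2 / (6 * V)))" if k: "k \<le> N" for k
  proof -
    define p where "p = real k / real N"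
    define x where "x = \<bar>2 * p - 1\<bar>"
    define F where "F = measure_pmf.expectation (iid_spins N p) f"
    have x4: "(2 * (real k / real N) - 1) ^ 4 = x ^ 4"
      by (simp add: x_def p_def)
    have p: "0 \<le> p" "p \<le> 1" using k N by (auto simp: p_def)
    have Fa: "\<bar>F - a\<bar> \<le> real N * x / 2"
    proof -
      have "\<bar>p - 1 / 2\<bar> = x / 2" by (simp add: x_def abs_if)
      then show ?thesis
        using iid_spins_expectation_Lipschitz[OF f p, of "1/2"] by (simp only: F_def a_def times_divide_eq_right)
    qed
    have "exp (- (real N * x ^ 4 / 12)) * measure_pmf.prob (iid_spins N p) {w. \<bar>f w - a\<bar> \<ge> t}
      \<le> 2 * exp (- (t\<^sup>2 / (6 * V)))"
    proof (cases "real N * x \<le> t")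
      \<comment> \<open>Here \<open>F\<close> lies within \<open>N * x / 2 \<le> t / 2\<close> of
        \<open>a\<close>, so a deviation \<open>t\<close> from \<open>a\<close> forces a deviation
        \<open>t / 2\<close> from \<open>F\<close>. McDiarmid's exponent
        \<open>t\<^sup>2 / (2 * N)\<close> is more than enough, as \<open>V \<ge> N\<close>.\<close>
      case True
      have "measure_pmf.prob (iid_spins N p) {w. \<bar>f w - a\<bar> \<ge> t}
          \<le> measure_pmf.prob (iid_spins N p) {w. \<bar>f w - F\<bar> \<ge> t / 2}"
      proof (intro measure_pmf.finite_measure_mono subsetI CollectI)
        fix w assume "w \<in> {w. t \<le> \<bar>f w - a\<bar>}"
        then have "t \<le> \<bar>f w - a\<bar>" by simp
        with True Fa show "t / 2 \<le> \<bar>f w - F\<bar>" by linarith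
      qed simp
      also have "\<dots> \<le> 2 * exp (- 2 * (t / 2)\<^sup>2 / N)"
        unfolding F_def using N t by (intro iid_spins_concentration f) auto
      also have "\<dots> \<le> 2 * exp (- (t\<^sup>2 / (6 * V)))"
      proof -
        have "t\<^sup>2 / (6 * V) \<le> t\<^sup>2 / (2 * real N)"
          using V N by (intro divide_left_mono) auto
        then show ?thesis by (simp add: power_divide)
      qed
      finally have "measure_pmf.prob (iid_spins N p) {w. \<bar>f w - a\<bar> \<ge> t} \<le> 2 * exp (- (t\<^sup>2 / (6 * V)))" .
      moreover have "exp (- (real N * x ^ 4 / 12)) \<le> 1" by simp
      ultimately show ?thesis
        using mult_mono[of "exp (- (real N * x ^ 4 / 12))" 1] by (metis exp_ge_zero measure_nonneg mult_1 zero_le_one)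
    next
      case False
      then have "t ^ 4 \<le> (real N * x) ^ 4" using t by (intro power_mono) auto
      then have "t ^ 4 / V\<^sup>2 \<le> real N * x ^ 4"
        using N unfolding V(3) by (simp add: field_simps power4_eq_xxxx power3_eq_cube)
      \<comment> \<open>With \<open>s = t\<^sup>2 / V\<close>, the inequality
        \<open>s\<^sup>2 \<ge> 2 * s - 1\<close> makes the quartic exponent linear in
        \<open>s\<close>: \<open>s\<^sup>2 / 12 \<ge> s / 6 - 1 / 12\<close>. This fixes the
        constant 6, and \<open>exp (1 / 12)\<close> fits into the prefactor 2.\<close>
      moreover have "t ^ 4 / V\<^sup>2 \<ge> 2 * (t\<^sup>2 / V) - 1"
        using zero_le_power2[of "t\<^sup>2 / V - 1"] by (simp add: power2_diff power_divide)
      ultimately have "- (real N * x ^ 4 / 12) \<le> 1 / 12 - t\<^sup>2 / (6 * V)"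
        by (simp add: field_simps)
      then have "exp (- (real N * x ^ 4 / 12)) \<le> exp (1 / 12 - t\<^sup>2 / (6 * V))" by simp
      also have "\<dots> = exp (1 / 12) * exp (- (t\<^sup>2 / (6 * V)))"
        by (simp add: exp_add[symmetric])
      also have "\<dots> \<le> 2 * exp (- (t\<^sup>2 / (6 * V)))"
      proof -
        have "exp (1 / 12) \<le> exp (ln (2::real))"
          using ln2_ge_two_thirds by (intro iffD2[OF exp_le_cancel_iff]) simp
        then show ?thesis by simp
      qed
      finally have "exp (- (real N * x ^ 4 / 12)) \<le> 2 * exp (- (t\<^sup>2 / (6 * V)))" .
      moreover have "measure_pmf.prob (iid_spins N p) {w. \<bar>f w - a\<bar> \<ge> t} \<le> 1" by simp
      ultimately show ?thesis
        using mult_mono[of "exp (- (real N * x ^ 4 / 12))" "2 * exp (- (t\<^sup>2 / (6 * V)))"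
            "measure_pmf.prob (iid_spins N p) {w. \<bar>f w - a\<bar> \<ge> t}" 1] by simp
    qed
    then show ?thesis by (simp only: x4 p_def)
  qed
  have "measure_pmf.prob (critical_curie_weiss N) {w. \<bar>f w - a\<bar> \<ge> t}
      \<le> (\<Sum>k\<le>N. 2 * exp (- (t\<^sup>2 / (6 * V))))"
    using N by (intro order_trans[OF prob_critical_curie_weiss_le] sum_mono mixture) auto
  then show ?thesis by (simp add: a_def V_def algebra_simps)
qed

section \<open>Replacing the reference mean by the true mean\<close>

text \<open>Split the mean of \<open>\<bar>f - a\<bar>\<close> at the level \<open>u\<close>: below
  it the integrand is at most \<open>u\<close>, above it at most \<open>B\<close>.\<close>

lemma abs_expectation_pmf_minus_le_tail:
  fixes f :: "'a \<Rightarrow> real"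
  assumes fin: "finite (set_pmf P)" and bd: "\<And>w. w \<in> set_pmf P \<Longrightarrow> \<bar>f w - a\<bar> \<le> B"
    and u: "u \<ge> 0"
  shows "\<bar>measure_pmf.expectation P f - a\<bar> \<le> u + B * measure_pmf.prob P {w. \<bar>f w - a\<bar> \<ge> u}"
proof -
  have "\<bar>measure_pmf.expectation P f - measure_pmf.expectation P (\<lambda>_. a)\<bar>
      \<le> measure_pmf.expectation P (\<lambda>w. u + B * indicator {w. \<bar>f w - a\<bar> \<ge> u} w)"
    by (rule abs_expectation_pmf_diff_le[OF fin])
       (auto simp: indicator_def intro!: add_increasing[OF u] bd)
  also have "\<dots> = u + B * measure_pmf.prob P {w. \<bar>f w - a\<bar> \<ge> u}"
    by (subst Bochner_Integration.integral_add) (auto intro: integrable_measure_pmf_finite[OF fin])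
  finally show ?thesis by simp
qed

lemma two_thirds_le_ln: "2 / 3 \<le> ln (real n)" if "n \<ge> 2"
proof -
  have "ln 2 \<le> ln (real n)" using that by (subst ln_le_cancel_iff) auto
  with ln2_ge_two_thirds show ?thesis by linarith
qed

text \<open>The constant 18 makes \<open>u\<^sup>2 / (6 * V)\<close> equal to
  \<open>3 * ln N\<close>, with \<open>V\<close> the power \<open>N powr (3/2)\<close>. The tail at
  \<open>u\<close> is then at most \<open>2 * (N + 1) / N ^ 3\<close>. Multiplied by the crude bound
  \<open>N\<close> on \<open>\<bar>f - a\<bar>\<close>, it contributes at most 2, and
  \<open>2 \<le> u\<close>.\<close>

lemma critical_curie_weiss_expectation:
  assumes f: "hamming_1_Lipschitz N f" and N: "N \<ge> 2"
  defines "u \<equiv> sqrt (18 * real N powr (3/2) * ln (real N))"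
  shows "\<bar>measure_pmf.expectation (critical_curie_weiss N) f
    - measure_pmf.expectation (iid_spins N (1/2)) f\<bar> \<le> 2 * u"
proof -
  define a where "a = measure_pmf.expectation (iid_spins N (1/2)) f"
  let ?\<pi> = "critical_curie_weiss N"
  have V: "real N powr (3/2) \<ge> real N"
    using N powr_mono[of 1 "3/2" "real N"] by simp
  have L: "ln (real N) \<ge> 2 / 3"
    using N by (rule two_thirds_le_ln)
  have set_\<pi>: "set_pmf ?\<pi> \<subseteq> spin_configs N"
    by (auto simp: set_pmf_iff pmf_critical_curie_weiss split: if_splits)
  \<comment> \<open>\<open>a\<close> is an average of values of \<open>f\<close> on
    \<open>spin_configs N\<close>, which has Hamming diameter at most \<open>N\<close>.\<close>
  have bd: "\<bar>f w - a\<bar> \<le> real N" if w: "w \<in> spin_configs N" for w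
  proof -
    have "\<bar>measure_pmf.expectation (iid_spins N (1/2)) (\<lambda>_. f w) - a\<bar>
        \<le> measure_pmf.expectation (iid_spins N (1/2)) (\<lambda>_. real N)"
      unfolding a_def using set_iid_spins[of N "1/2"] finite_spin_configs
      by (intro abs_expectation_pmf_diff_le hamming_1_Lipschitz_diff_le[OF f w])
         (auto intro: finite_subset)
    then show ?thesis by simp
  qed
  have u2: "u\<^sup>2 = 18 * real N powr (3/2) * ln (real N)"
    unfolding u_def using L by simp
  have "12 \<le> 18 * real N powr (3/2) * ln (real N)"
  proof -
    have "1 * (2/3) \<le> real N powr (3/2) * ln (real N)"
      using V L N by (intro mult_mono) auto
    then show ?thesis by (simp add: mult.commute)
  qed
  then have u: "2 \<le> u"
    unfolding u_def by (intro real_le_rsqrt) simp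
  have "\<bar>measure_pmf.expectation ?\<pi> f - a\<bar> \<le> u + real N * measure_pmf.prob ?\<pi> {w. \<bar>f w - a\<bar> \<ge> u}"
    using u bd set_\<pi> finite_subset[OF set_\<pi> finite_spin_configs]
    by (intro abs_expectation_pmf_minus_le_tail) auto
  also have "measure_pmf.prob ?\<pi> {w. \<bar>f w - a\<bar> \<ge> u}
      \<le> 2 * (real N + 1) * exp (- (u\<^sup>2 / (6 * real N powr (3/2))))"
    unfolding a_def using u N by (intro critical_curie_weiss_tail f) auto
  also have "u\<^sup>2 / (6 * real N powr (3/2)) = real 3 * ln (real N)"
    unfolding u2 using N by simp
  also have "exp (- (real 3 * ln (real N))) = 1 / real N ^ 3"
    using N by (simp add: exp_minus exp_of_nat_mult[of 3, simplified] inverse_eq_divide)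
  also have "real N * (2 * (real N + 1) * (1 / real N ^ 3)) = 2 * (real N + 1) / (real N)\<^sup>2"
    using N by (simp add: field_simps power3_eq_cube power2_eq_square)
  also have "\<dots> \<le> 2"
  proof -
    have "2 * real N \<le> real N * real N" using N by (intro mult_right_mono) auto
    moreover have "real N \<ge> 2" using N by simp
    ultimately have "real N + 1 \<le> (real N)\<^sup>2" unfolding power2_eq_square by linarith
    then show ?thesis using N by (simp add: field_simps)
  qed
  finally show ?thesis using u N by (simp add: a_def)
qed

theorem proposition4p11:
  "\<exists>C::real. C > 0 \<and>
    (\<forall>N\<ge>2. \<forall>f. hamming_1_Lipschitz N f \<longrightarrow>
      (\<forall>t\<ge>0.
        measure_pmf.prob (critical_curie_weiss N)
          {x. \<bar>f x - measure_pmf.expectation (critical_curie_weiss N) f\<bar> \<ge> t}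
        \<le> 2 * exp (- (t\<^sup>2 / (2 * C * real N powr (3/2) * ln (real N))))))"
proof (intro exI[of _ 288] conjI allI impI)
  fix N :: nat and f :: "(nat \<Rightarrow> real) \<Rightarrow> real" and t :: real
  assume N: "N \<ge> 2" and f: "hamming_1_Lipschitz N f" and t: "t \<ge> 0"
  define V where "V = real N powr (3/2)"
  define L where "L = ln (real N)"
  define u where "u = sqrt (18 * V * L)"
  define a where "a = measure_pmf.expectation (iid_spins N (1/2)) f"
  let ?\<pi> = "critical_curie_weiss N"
  let ?E = "measure_pmf.expectation ?\<pi> f"
  let ?G = "{x. \<bar>f x - ?E\<bar> \<ge> t}"
  have V: "V > 0" using N by (simp add: V_def)
  have L: "L \<ge> 2 / 3"
    unfolding L_def using N by (rule two_thirds_le_ln)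
  have u: "u \<ge> 0" "u\<^sup>2 = 18 * V * L" using V L by (auto simp: u_def)
  have Ea: "\<bar>?E - a\<bar> \<le> 2 * u"
    using critical_curie_weiss_expectation[OF f N] by (simp add: a_def u_def V_def L_def)
  \<comment> \<open>The constant is \<open>576 = 2 * 288\<close> with \<open>288 = 16 * 18\<close>,
    so that \<open>t\<^sup>2 \<le> (4 * u)\<^sup>2 = 288 * V * L\<close> gives an exponent of at
    most \<open>1 / 2 < ln 2\<close>. The bound then exceeds 1 and holds trivially up to
    \<open>4 * u\<close>.\<close>
  have "measure_pmf.prob ?\<pi> ?G \<le> 2 * exp (- (t\<^sup>2 / (576 * V * L)))"
  proof (cases "t \<le> 4 * u")
    case True
    then have "t\<^sup>2 \<le> (4 * u)\<^sup>2" using t by (intro power_mono) auto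
    then have "t\<^sup>2 / (576 * V * L) \<le> 1 / 2"
      using u V L by (simp add: field_simps power_mult_distrib)
    then have "- ln 2 \<le> - (t\<^sup>2 / (576 * V * L))"
      using ln2_ge_two_thirds by linarith
    then have "exp (- ln 2) \<le> exp (- (t\<^sup>2 / (576 * V * L)))" by simp
    then have "1 \<le> 2 * exp (- (t\<^sup>2 / (576 * V * L)))" by (simp add: exp_minus)
    then show ?thesis using measure_pmf.prob_le_1[of ?\<pi> ?G] by linarith
  next
    case False
    \<comment> \<open>Beyond \<open>4 * u\<close> the distance of at most \<open>2 * u\<close>
      between \<open>?E\<close> and \<open>a\<close> costs less than half of
      \<open>t\<close>.\<close>
    have "measure_pmf.prob ?\<pi> ?G \<le> measure_pmf.prob ?\<pi> {x. \<bar>f x - a\<bar> \<ge> t / 2}"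
    proof (intro measure_pmf.finite_measure_mono subsetI CollectI)
      fix x assume "x \<in> ?G"
      then have "t \<le> \<bar>f x - ?E\<bar>" by simp
      with False Ea show "t / 2 \<le> \<bar>f x - a\<bar>" by linarith
    qed simp
    also have "\<dots> \<le> 2 * (real N + 1) * exp (- ((t / 2)\<^sup>2 / (6 * V)))"
      unfolding a_def V_def using N t by (intro critical_curie_weiss_tail f) auto
    \<comment> \<open>The number \<open>N + 1\<close> of product measures is at most
      \<open>N\<^sup>2 = exp (2 * L)\<close>, so it enters the exponent as a multiple of the
      logarithm.\<close>
    also have "\<dots> \<le> 2 * exp (2 * L) * exp (- ((t / 2)\<^sup>2 / (6 * V)))"
    proof -
      have "exp (2 * L) = (real N)\<^sup>2"
        using N by (simp add: L_def exp_double)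
      moreover have "2 * real N \<le> real N * real N" using N by (intro mult_right_mono) auto
      moreover have "real N \<ge> 2" using N by simp
      ultimately have "real N + 1 \<le> exp (2 * L)" unfolding power2_eq_square by linarith
      then show ?thesis by simp
    qed
    also have "\<dots> = 2 * exp (2 * L - t\<^sup>2 / V / 24)"
      by (simp add: exp_add[symmetric] power_divide)
    also have "\<dots> \<le> 2 * exp (- (t\<^sup>2 / (576 * V * L)))"
    proof -
      \<comment> \<open>With \<open>s = t\<^sup>2 / V\<close>, the condition
        \<open>t > 4 * u\<close> gives \<open>2 * L \<le> s / 144\<close>. What remains of
        \<open>s / 24\<close> is at least \<open>5 * s / 144\<close>, which exceeds
        \<open>s / 48\<close>; and \<open>L \<ge> 2 / 3\<close> gives
        \<open>576 * L \<ge> 48\<close>.\<close>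
      have "(4 * u)\<^sup>2 \<le> t\<^sup>2" using False u by (intro power_mono) auto
      then have tV: "288 * L \<le> t\<^sup>2 / V" using u V by (simp add: field_simps power_mult_distrib)
      have "t\<^sup>2 / (576 * V * L) = t\<^sup>2 / V / (576 * L)" by simp
      also have "\<dots> \<le> t\<^sup>2 / V / 48" using L V by (intro divide_left_mono) auto
      finally show ?thesis using tV L by simp
    qed
    finally show ?thesis .
  qed
  then show "measure_pmf.prob ?\<pi> ?G \<le> 2 * exp (- (t\<^sup>2 / (2 * 288 * real N powr (3/2) * ln (real N))))"
    by (simp add: V_def L_def)
qed simp

end
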